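(* For every integer $n \geq 2$ and every real $\rho \in (0,1)$, the $\mathrm{SA}_+$-rank of $P_{n,\rho} := \{x \in [0,1]^n : \sum_{i=1}^n x_i \leq n-\rho\}$ is $n$.
   Context: Notation. $[n] := \{1,\ldots,n\}$. For $P \subseteq [0,1]^n$, the integer hull is $P_I := \mathrm{conv}(P \cap \{0,1\}^n)$, and $K(P) := \{ (\lambda, \lambda x) \in \mathbb{R}^{n+1} : \lambda \geq 0,\ x \in P\}$ (the extra coordinate is indexed by $0$). Let $\mathcal{F} := \{0,1\}^n$. For $S \subseteq [n]$ and $t \in \{0,1\}$, let $S|_t := \{x \in \mathcal{F} : x_i = t \ \forall i \in S\}$ (so $\emptyset|_0=\emptyset|_1=\mathcal{F}$), and write $i|_t$ for $\{i\}|_t$. For an integer $\ell \ge 0$, let $\mathcal{A}_\ell := \{S|_1 \cap T|_0 : S,T \subseteq [n],\ S \cap T = \emptyset,\ |S|+|T| \leq \ell\}$. For a vector $y$ indexed by a family of subsets of $\mathcal{F}$ containing $\mathcal{F}$ and all $i|_1$, let $\hat{x}(y) := (y_{\mathcal{F}}, y_{1|_1}, \ldots, y_{n|_1})^\top$. For a matrix $Y$, $Y e_\alpha$ denotes its column indexed by $\alpha$. The operator $\mathrm{SA}_+^k$ ($k \geq 1$ an integer). Let $\widehat{\mathrm{SA}}_+^k(P)$ be the set of real symmetric positive semidefinite matrices $Y$ with rows and columns indexed by $\mathcal{A}_k$ such that: (1) $Y[\mathcal{F},\mathcal{F}] = 1$; (2) for every $\alpha \in \mathcal{A}_k$: $\hat{x}(Y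 e_\alpha) \in K(P)$ and $Y e_\alpha \geq 0$; (3) for every $S|_1 \cap T|_0 \in \mathcal{A}_{k-1}$ (with $S\cap T=\emptyset$, $|S|+|T|\le k-1$) and every $j \in [n]\setminus(S \cup T)$: $Y e_{S|_1 \cap T|_0 \cap j|_1} + Y e_{S|_1 \cap T|_0 \cap j|_0} = Y e_{S|_1 \cap T|_0}$; (4) for all $\alpha,\beta \in \mathcal{A}_k$ with $\alpha \cap \beta = \emptyset$: $Y[\alpha,\beta] = 0$; (5) for all $\alpha_1,\alpha_2,\beta_1,\beta_2 \in \mathcal{A}_k$ with $\alpha_1 \cap \beta_1 = \alpha_2 \cap \beta_2$: $Y[\alpha_1,\beta_1] = Y[\alpha_2,\beta_2]$. Then $\mathrm{SA}_+^k(P) := \{x \in \mathbb{R}^n : \exists\, Y \in \widehat{\mathrm{SA}}_+^k(P),\ \hat{x}(Y e_{\mathcal{F}}) = (1,x)^\top\}$, and $\mathrm{SA}_+^0(P) := P$. The $\mathrm{SA}_+$-rank of $P$ is the smallest integer $k \geq 0$ such that $\mathrm{SA}_+^k(P) = P_I$. *)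

theory Defs
  imports "HOL-Analysis.Analysis" "HOL-Library.Extended_Nat"
begin

text \<open>
  The finite type \<open>'n\<close> plays the role of \<open>[n]\<close>, with \<open>n = CARD('n)\<close>.  The space
  \<open>R^(n+1)\<close>, whose extra coordinate has index \<open>0\<close>, is rendered as \<open>real \<times> (real ^ 'n)\<close>.
\<close>

definition cube01 :: "(real ^ 'n) set" where
  "cube01 = {x. \<forall>i. x $ i \<in> {0, 1}}"

definition integer_hull :: "(real ^ 'n) set \<Rightarrow> (real ^ 'n) set" where
  "integer_hull P = convex hull (P \<inter> cube01)"

definition homog_cone :: "(real ^ 'n) set \<Rightarrow> (real \<times> (real ^ 'n)) set" where
  "homog_cone P = {(l, l *\<^sub>R x) | l x. 0 \<le> l \<and> x \<in> P}"

definition face :: "'n set \<Rightarrow> real \<Rightarrow> (real ^ 'n) set" where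
  "face S t = {x \<in> cube01. \<forall>i\<in>S. x $ i = t}"

definition index_family :: "nat \<Rightarrow> (real ^ 'n::finite) set set" where
  "index_family l =
     {face S 1 \<inter> face T 0 | S T. S \<inter> T = {} \<and> card S + card T \<le> l}"

definition xhat :: "((real ^ 'n) set \<Rightarrow> real) \<Rightarrow> real \<times> (real ^ 'n)" where
  "xhat y = (y cube01, \<chi> i. y (face {i} 1))"

text \<open>
  A matrix with rows and columns indexed by a finite set \<open>A\<close> is a function of two arguments;
  only its values on \<open>A \<times> A\<close> are relevant.
\<close>

definition symmetric_on :: "'a set \<Rightarrow> ('a \<Rightarrow> 'a \<Rightarrow> real) \<Rightarrow> bool" where
  "symmetric_on A Y \<longleftrightarrow> (\<forall>\<alpha>\<in>A. \<forall>\<beta>\<in>A. Y \<alpha> \<beta> = Y \<beta> \<alpha>)"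

definition psd_on :: "'a set \<Rightarrow> ('a \<Rightarrow> 'a \<Rightarrow> real) \<Rightarrow> bool" where
  "psd_on A Y \<longleftrightarrow> symmetric_on A Y \<and>
     (\<forall>v :: 'a \<Rightarrow> real. 0 \<le> (\<Sum>\<alpha>\<in>A. \<Sum>\<beta>\<in>A. v \<alpha> * Y \<alpha> \<beta> * v \<beta>))"

definition mat_col :: "('a \<Rightarrow> 'a \<Rightarrow> real) \<Rightarrow> 'a \<Rightarrow> 'a \<Rightarrow> real" where
  "mat_col Y \<alpha> = (\<lambda>\<beta>. Y \<beta> \<alpha>)"

definition SA_plus_lift ::
    "nat \<Rightarrow> (real ^ 'n::finite) set \<Rightarrow> ((real ^ 'n) set \<Rightarrow> (real ^ 'n) set \<Rightarrow> real) set" where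
  "SA_plus_lift k P = {Y.
     psd_on (index_family k) Y \<and>
     Y cube01 cube01 = 1 \<and>
     (\<forall>\<alpha>\<in>index_family k.
        xhat (mat_col Y \<alpha>) \<in> homog_cone P \<and>
        (\<forall>\<beta>\<in>index_family k. 0 \<le> mat_col Y \<alpha> \<beta>)) \<and>
     (\<forall>S T. S \<inter> T = {} \<and> card S + card T \<le> k - 1 \<longrightarrow>
        (\<forall>j. j \<notin> S \<union> T \<longrightarrow>
          (\<forall>\<beta>\<in>index_family k.
             mat_col Y (face S 1 \<inter> face T 0 \<inter> face {j} 1) \<beta> +
             mat_col Y (face S 1 \<inter> face T 0 \<inter> face {j} 0) \<beta> =
             mat_col Y (face S 1 \<inter> face T 0) \<beta>))) \<and>
     (\<forall>\<alpha>\<in>index_family k. \<forall>\<beta>\<in>index_family k. \<alpha> \<inter> \<beta> = {} \<longrightarrow> Y \<alpha> \<beta> = 0) \<and>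
     (\<forall>\<alpha>1\<in>index_family k. \<forall>\<alpha>2\<in>index_family k.
      \<forall>\<beta>1\<in>index_family k. \<forall>\<beta>2\<in>index_family k.
        \<alpha>1 \<inter> \<beta>1 = \<alpha>2 \<inter> \<beta>2 \<longrightarrow> Y \<alpha>1 \<beta>1 = Y \<alpha>2 \<beta>2)}"

definition SA_plus :: "nat \<Rightarrow> (real ^ 'n::finite) set \<Rightarrow> (real ^ 'n) set" where
  "SA_plus k P =
     (if k = 0 then P
      else {x. \<exists>Y\<in>SA_plus_lift k P. xhat (mat_col Y cube01) = (1, x)})"

text \<open>
  The infimum is taken in \<open>enat\<close>, so the rank is \<open>\<infinity>\<close> if no \<open>k\<close> has the required
  property, and a finite value is attained as a minimum.
\<close>

definition SA_plus_rank :: "(real ^ 'n::finite) set \<Rightarrow> enat" where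
  "SA_plus_rank P = (INF k\<in>{k. SA_plus k P = integer_hull P}. enat k)"

definition P_poly :: "real \<Rightarrow> (real ^ 'n::finite) set" where
  "P_poly \<rho> = {x. (\<forall>i. 0 \<le> x $ i \<and> x $ i \<le> 1) \<and>
                   (\<Sum>i\<in>UNIV. x $ i) \<le> real CARD('n) - \<rho>}"

end

theory Submission
  imports Defs
begin

text \<open>
  Write \<open>n = CARD('n)\<close>.  The operator is best read through measures on the vertices of the
  cube: a probability measure \<open>w\<close> on \<open>{0,1}^n\<close> defines the matrix \<open>Y[\<alpha>,\<beta>] = w(\<alpha> \<inter> \<beta>)\<close>.
  Such a matrix is automatically positive semidefinite, additive under splitting a face, and
  consistent, so it lies in the lifted set for \<open>P\<close> as soon as, for every index \<open>\<alpha>\<close> with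
  \<open>w(\<alpha>) > 0\<close>, the conditional mean of a \<open>w\<close>-random vertex given \<open>\<alpha>\<close> lies in \<open>P\<close>
  (\<open>barycenter_mem_SA_plus\<close>).  The represented point of the relaxation is the mean of \<open>w\<close>.

  Level \<open>n\<close> suffices, for every convex \<open>P\<close> in place of \<open>P_poly \<rho>\<close>.  The singletons \<open>{p}\<close> are
  then indices, and splitting one coordinate at a time writes the column of the whole cube as
  the sum of their columns.  The column of \<open>{p}\<close> represents a multiple of \<open>p\<close> itself, so the
  cone condition forces its weight to vanish unless \<open>p \<in> P\<close>: the represented point is a convex
  combination of vertices in \<open>P\<close>.  Conversely, measures carried by the vertices in \<open>P\<close> put the
  integer hull inside every level (\<open>SA_plus_CARD_eq_integer_hull\<close>).

  A level \<open>k < n\<close> does not suffice, because each of its indices is a face of positive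
  dimension.  Put mass on the infeasible all-ones vertex and on its \<open>n\<close> neighbours, in the ratio
  \<open>(1 - \<rho>) : \<rho>\<close> between it and each neighbour.  A face of positive dimension
  containing the all-ones vertex contains one of the neighbours as well; conditioning on an edge
  between them gives coordinate sum exactly \<open>n - \<rho>\<close>, and larger faces give less.  So the mean
  of this measure survives, while its coordinate sum exceeds \<open>n - 1\<close>, which is the maximum on the
  integer hull (\<open>SA_plus_P_poly_beyond_integer_hull\<close>).
\<close>

section \<open>The vertices of the cube and its faces\<close>

definition vertex :: "'n set \<Rightarrow> real ^ 'n" where
  "vertex S = (\<chi> i. of_bool (i \<in> S))"

lemma cube01_eq_range_vertex: "cube01 = range (vertex :: 'n set \<Rightarrow> real ^ 'n)"
proof (intro equalityI subsetI)
  fix x :: "real ^ 'n" assume "x \<in> cube01"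
  then have "x = vertex {i. x $ i = 1}"
    by (auto simp: cube01_def vertex_def vec_eq_iff)
  then show "x \<in> range vertex" by blast
qed (auto simp: cube01_def vertex_def)

lemma sum_vertex: "(\<Sum>i\<in>UNIV. vertex S $ i) = real (card (S :: 'n::finite set))"
  by (simp add: vertex_def)

lemma finite_cube01 [simp]: "finite (cube01 :: (real ^ 'n::finite) set)"
  by (simp add: cube01_eq_range_vertex)

lemma face_empty [simp]: "face {} t = cube01"
  by (simp add: face_def)

lemma face_subset_cube01: "face S t \<subseteq> cube01"
  by (auto simp: face_def)

lemma finite_face [simp]: "finite (face S t :: (real ^ 'n::finite) set)"
  using finite_subset[OF face_subset_cube01 finite_cube01] .

lemma index_family_subset_cube01: "\<alpha> \<in> index_family k \<Longrightarrow> \<alpha> \<subseteq> cube01"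
  by (auto simp: index_family_def face_def)

lemma finite_index_family [simp]: "finite (index_family k :: (real ^ 'n::finite) set set)"
  by (rule finite_subset[of _ "Pow cube01"]) (use index_family_subset_cube01 in auto)

lemma face_Int_mem_index_family:
  "S \<inter> T = {} \<Longrightarrow> card S + card T \<le> k \<Longrightarrow> face S 1 \<inter> face T 0 \<in> index_family k"
  by (auto simp: index_family_def)

lemma cube01_mem_index_family: "cube01 \<in> index_family k"
  using face_Int_mem_index_family[of "{}" "{}" k] by simp

lemma face_singleton_mem_index_family: "1 \<le> k \<Longrightarrow> face {i} 1 \<in> index_family k"
  using face_Int_mem_index_family[of "{i}" "{}" k] face_subset_cube01[of "{i}" 1]
  by (simp add: Int_absorb2)

lemma face_Int_singleton:
  "face S 1 \<inter> face T 0 \<inter> face {j} 1 = face (insert j S) 1 \<inter> face T 0"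
  "face S 1 \<inter> face T 0 \<inter> face {j} 0 = face S 1 \<inter> face (insert j T) 0"
  by (auto simp: face_def)

text \<open>
  Serves both directions: it gives the splitting condition for the matrix of a measure, and it
  assembles the vertices of a face in the induction that decomposes a column.
\<close>

lemma sum_split_coordinate:
  fixes A :: "(real ^ 'n::finite) set" and f :: "real ^ 'n \<Rightarrow> 'b::comm_monoid_add"
  assumes "A \<subseteq> cube01"
  shows "sum f (A \<inter> face {j} 1) + sum f (A \<inter> face {j} 0) = sum f A"
proof -
  have "A = (A \<inter> face {j} 1) \<union> (A \<inter> face {j} 0)"
    using assms by (auto simp: face_def cube01_def)
  moreover have "(A \<inter> face {j} 1) \<inter> (A \<inter> face {j} 0) = {}"
    by (auto simp: face_def)
  ultimately show ?thesis
    by (metis finite_Int finite_face sum.union_disjoint)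
qed

lemma singleton_vertex_eq_face:
  fixes p :: "real ^ 'n::finite"
  assumes "p \<in> cube01"
  shows "{p} = face {i. p $ i = 1} 1 \<inter> face {i. p $ i = 0} 0"
  using assms by (auto simp: face_def cube01_def vec_eq_iff) metis

lemma face_Int_eq_singleton:
  fixes S T :: "'n::finite set"
  assumes "S \<inter> T = {}" "S \<union> T = UNIV"
  shows "face S 1 \<inter> face T 0 = {vertex S}"
proof -
  have "{i. vertex S $ i = 1} = S" "{i. vertex S $ i = 0} = T"
    using assms by (auto simp: vertex_def)
  then show ?thesis
    using singleton_vertex_eq_face[of "vertex S"] by (simp add: cube01_eq_range_vertex)
qed

lemma singleton_mem_index_family:
  fixes p :: "real ^ 'n::finite"
  assumes p: "p \<in> cube01"
  shows "{p} \<in> index_family CARD('n)"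
proof -
  have disj: "{i. p $ i = 1} \<inter> {i. p $ i = 0} = {}" by auto
  have "card {i. p $ i = 1} + card {i. p $ i = 0} \<le> CARD('n)"
    by (subst card_Un_disjoint[symmetric]) (use disj in \<open>auto intro: card_mono\<close>)
  then show ?thesis
    using face_Int_mem_index_family[OF disj] singleton_vertex_eq_face[OF p] by simp
qed

lemma mem_homog_coneI: "0 \<le> l \<Longrightarrow> x \<in> P \<Longrightarrow> (l, l *\<^sub>R x) \<in> homog_cone P"
  unfolding homog_cone_def by blast

section \<open>Measures on the cube give points of the relaxation\<close>

text \<open>
  The matrix is a nonnegative combination of rank-one matrices, one for each point \<open>p\<close>, built
  from the vector that records which sets contain \<open>p\<close>.
\<close>

lemma psd_on_sum_Int:
  fixes w :: "'a \<Rightarrow> real"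
  assumes "finite A" "finite C" "\<And>\<alpha>. \<alpha> \<in> A \<Longrightarrow> \<alpha> \<subseteq> C" "\<And>p. p \<in> C \<Longrightarrow> 0 \<le> w p"
  shows "psd_on A (\<lambda>\<alpha> \<beta>. sum w (\<alpha> \<inter> \<beta>))"
proof -
  have expand: "sum w (\<alpha> \<inter> \<beta>) = (\<Sum>p\<in>C. w p * indicator \<alpha> p * indicator \<beta> p)"
    if "\<alpha> \<in> A" for \<alpha> \<beta>
  proof -
    have "\<alpha> \<inter> \<beta> = C \<inter> (\<alpha> \<inter> \<beta>)" using assms(3)[OF that] by blast
    then have "sum w (\<alpha> \<inter> \<beta>) = (\<Sum>p\<in>C. if p \<in> \<alpha> \<inter> \<beta> then w p else 0)"
      using sum.inter_restrict[OF assms(2), of w "\<alpha> \<inter> \<beta>"] by simp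
    also have "\<dots> = (\<Sum>p\<in>C. w p * indicator \<alpha> p * indicator \<beta> p)"
      by (intro sum.cong) (auto simp: indicator_def)
    finally show ?thesis .
  qed
  have "0 \<le> (\<Sum>\<alpha>\<in>A. \<Sum>\<beta>\<in>A. v \<alpha> * sum w (\<alpha> \<inter> \<beta>) * v \<beta>)" for v :: "'a set \<Rightarrow> real"
  proof -
    have "(\<Sum>\<alpha>\<in>A. \<Sum>\<beta>\<in>A. v \<alpha> * sum w (\<alpha> \<inter> \<beta>) * v \<beta>)
        = (\<Sum>\<alpha>\<in>A. \<Sum>\<beta>\<in>A. \<Sum>p\<in>C. w p * ((v \<alpha> * indicator \<alpha> p) * (v \<beta> * indicator \<beta> p)))"
      by (intro sum.cong refl) (simp add: expand sum_distrib_left sum_distrib_right ac_simps)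
    also have "\<dots> = (\<Sum>\<alpha>\<in>A. \<Sum>p\<in>C. \<Sum>\<beta>\<in>A. w p * ((v \<alpha> * indicator \<alpha> p) * (v \<beta> * indicator \<beta> p)))"
      by (intro sum.cong refl, rule sum.swap)
    also have "\<dots> = (\<Sum>p\<in>C. \<Sum>\<alpha>\<in>A. \<Sum>\<beta>\<in>A. w p * ((v \<alpha> * indicator \<alpha> p) * (v \<beta> * indicator \<beta> p)))"
      by (rule sum.swap)
    also have "\<dots> = (\<Sum>p\<in>C. w p * (\<Sum>\<alpha>\<in>A. v \<alpha> * indicator \<alpha> p)\<^sup>2)"
      unfolding power2_eq_square sum_product by (simp only: sum_distrib_left)
    also have "\<dots> \<ge> 0"
      using assms(4) by (intro sum_nonneg mult_nonneg_nonneg) auto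
    finally show ?thesis .
  qed
  then show ?thesis
    by (simp add: psd_on_def symmetric_on_def Int_commute)
qed

text \<open>
  On a vertex, the \<open>i\<close>-th coordinate is the indicator of the face \<open>x\<^sub>i = 1\<close>; hence the point
  read off the column of \<open>\<alpha>\<close> is the unnormalised mean of \<open>w\<close> over \<open>\<alpha>\<close>.
\<close>

lemma xhat_sum_Int:
  fixes w :: "real ^ 'n::finite \<Rightarrow> real"
  assumes "\<alpha> \<subseteq> cube01"
  shows "xhat (\<lambda>\<beta>. sum w (\<beta> \<inter> \<alpha>)) = (sum w \<alpha>, \<Sum>p\<in>\<alpha>. w p *\<^sub>R p)"
proof -
  have fin: "finite \<alpha>" using assms finite_subset finite_cube01 by blast
  have "sum w (face {i} 1 \<inter> \<alpha>) = (\<Sum>p\<in>\<alpha>. w p * p $ i)" for i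
  proof -
    have "sum w (face {i} 1 \<inter> \<alpha>) = (\<Sum>p\<in>\<alpha>. if p \<in> face {i} 1 then w p else 0)"
      using sum.inter_restrict[OF fin, of w "face {i} 1"] by (simp add: Int_commute)
    also have "\<dots> = (\<Sum>p\<in>\<alpha>. w p * p $ i)"
      using assms by (intro sum.cong) (auto simp: face_def cube01_def)
    finally show ?thesis .
  qed
  moreover have "cube01 \<inter> \<alpha> = \<alpha>" using assms by blast
  ultimately show ?thesis
    by (simp add: xhat_def vec_eq_iff)
qed

text \<open>
  The one way in which points are shown to belong to the relaxation.  Beyond \<open>w\<close> being a
  probability measure, only membership in the cone has to be checked.  At \<open>k = 0\<close> the only index is the whole cube, and
  the hypothesis says that the mean itself lies in \<open>P\<close>.
\<close>

lemma barycenter_mem_SA_plus: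
  fixes w :: "real ^ 'n::finite \<Rightarrow> real"
  assumes nonneg: "\<And>p. p \<in> cube01 \<Longrightarrow> 0 \<le> w p"
    and total: "sum w cube01 = 1"
    and cone: "\<And>\<alpha>. \<alpha> \<in> index_family k \<Longrightarrow> (sum w \<alpha>, \<Sum>p\<in>\<alpha>. w p *\<^sub>R p) \<in> homog_cone P"
  shows "(\<Sum>p\<in>cube01. w p *\<^sub>R p) \<in> SA_plus k P"
proof (cases "k = 0")
  case True
  then show ?thesis
    using cone[OF cube01_mem_index_family] total by (auto simp: SA_plus_def homog_cone_def)
next
  case False
  define Y where "Y = (\<lambda>\<alpha> \<beta>. sum w (\<alpha> \<inter> \<beta>))"
  have col: "xhat (mat_col Y \<alpha>) = (sum w \<alpha>, \<Sum>p\<in>\<alpha>. w p *\<^sub>R p)" if "\<alpha> \<subseteq> cube01" for \<alpha>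
    using xhat_sum_Int[OF that] by (simp add: mat_col_def Y_def)
  have "psd_on (index_family k) Y"
    unfolding Y_def
    by (rule psd_on_sum_Int[OF _ finite_cube01 index_family_subset_cube01 nonneg]) auto
  moreover have "Y cube01 cube01 = 1" by (simp add: Y_def total)
  moreover have "xhat (mat_col Y \<alpha>) \<in> homog_cone P" if "\<alpha> \<in> index_family k" for \<alpha>
    using col[OF index_family_subset_cube01[OF that]] cone[OF that] by simp
  moreover have "0 \<le> mat_col Y \<alpha> \<beta>" if "\<beta> \<in> index_family k" for \<alpha> \<beta>
    unfolding mat_col_def Y_def
    using index_family_subset_cube01[OF that] nonneg by (intro sum_nonneg) auto
  moreover have "mat_col Y (face S 1 \<inter> face T 0 \<inter> face {j} 1) \<beta>
      + mat_col Y (face S 1 \<inter> face T 0 \<inter> face {j} 0) \<beta> = mat_col Y (face S 1 \<inter> face T 0) \<beta>"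
    for S T j \<beta>
    using sum_split_coordinate[of "\<beta> \<inter> (face S 1 \<inter> face T 0)" w j] face_subset_cube01[of S 1]
    by (simp add: mat_col_def Y_def Int_assoc le_infI1 le_infI2)
  ultimately have "Y \<in> SA_plus_lift k P"
    by (simp add: SA_plus_lift_def) (simp add: Y_def)
  moreover have "xhat (mat_col Y cube01) = (1, \<Sum>p\<in>cube01. w p *\<^sub>R p)"
    using col[of cube01] total by simp
  ultimately show ?thesis
    using False by (auto simp: SA_plus_def)
qed

section \<open>The relaxation of full level is the integer hull\<close>

text \<open>
  The weights live on the whole cube rather than on its vertices in \<open>P\<close>, so that they can be
  matched with the entries of a lifted matrix.
\<close>

lemma mem_integer_hull_iff:
  fixes P :: "(real ^ 'n::finite) set"
  shows "x \<in> integer_hull P \<longleftrightarrow>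
    (\<exists>w. (\<forall>p\<in>cube01. 0 \<le> w p) \<and> (\<forall>p\<in>cube01 - P. w p = 0) \<and> sum w cube01 = 1 \<and>
         (\<Sum>p\<in>cube01. w p *\<^sub>R p) = x)" (is "_ \<longleftrightarrow> ?R")
proof
  assume "x \<in> integer_hull P"
  then obtain u where u: "\<forall>p\<in>P \<inter> cube01. 0 \<le> u p" "sum u (P \<inter> cube01) = 1"
      "(\<Sum>p\<in>P \<inter> cube01. u p *\<^sub>R p) = x"
    unfolding integer_hull_def by (subst (asm) convex_hull_finite) auto
  define w where "w p = (if p \<in> P then u p else 0)" for p
  have "sum w cube01 = sum u (P \<inter> cube01)"
    unfolding w_def by (subst Int_commute, subst sum.inter_restrict) simp_all
  moreover have "(\<Sum>p\<in>cube01. w p *\<^sub>R p) = (\<Sum>p\<in>P \<inter> cube01. u p *\<^sub>R p)"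
    by (subst Int_commute, subst sum.inter_restrict) (auto simp: w_def intro!: sum.cong)
  ultimately show ?R
    using u by (intro exI[of _ w]) (auto simp: w_def)
next
  assume ?R
  then obtain w where w: "\<forall>p\<in>cube01. 0 \<le> w p" "\<forall>p\<in>cube01 - P. w p = 0" "sum w cube01 = 1"
      "(\<Sum>p\<in>cube01. w p *\<^sub>R p) = x" by blast
  have "sum w (P \<inter> cube01) = 1"
    using w by (subst sum.mono_neutral_left[of cube01]) auto
  moreover have "(\<Sum>p\<in>P \<inter> cube01. w p *\<^sub>R p) = x"
    unfolding w(4)[symmetric] using w(2) by (intro sum.mono_neutral_left) auto
  ultimately show "x \<in> integer_hull P"
    unfolding integer_hull_def using w(1) by (subst convex_hull_finite) auto
qed

text \<open>
  A measure carried by the vertices of a convex set satisfies the cone condition at every index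
  of every level, since its conditional means stay in that set.
\<close>

lemma weighted_sum_mem_homog_cone:
  assumes "finite A" "convex P" "P \<noteq> {}"
    and "\<And>p. p \<in> A \<Longrightarrow> 0 \<le> w p" "\<And>p. p \<in> A - P \<Longrightarrow> w p = 0"
  shows "(sum w A, \<Sum>p\<in>A. w p *\<^sub>R p) \<in> homog_cone P"
proof (cases "sum w A = 0")
  case True
  then have "\<And>p. p \<in> A \<Longrightarrow> w p = 0"
    using assms sum_nonneg_eq_0_iff by blast
  then show ?thesis
    using \<open>P \<noteq> {}\<close> by (force simp: homog_cone_def)
next
  case False
  let ?s = "sum w A"
  have s: "?s > 0" using False assms(4) by (simp add: order_less_le sum_nonneg)
  have restrict: "sum w (A \<inter> P) = ?s"
    using assms by (intro sum.mono_neutral_left) auto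
  have "(\<Sum>p\<in>A \<inter> P. (w p / ?s) *\<^sub>R p) \<in> P"
    using assms s restrict
    by (intro convex_sum) (auto simp: sum_divide_distrib[symmetric])
  moreover have "(\<Sum>p\<in>A \<inter> P. (w p / ?s) *\<^sub>R p) = (\<Sum>p\<in>A. (w p / ?s) *\<^sub>R p)"
    using assms by (intro sum.mono_neutral_left) auto
  moreover have "(\<Sum>p\<in>A. w p *\<^sub>R p) = ?s *\<^sub>R (\<Sum>p\<in>A. (w p / ?s) *\<^sub>R p)"
    using s by (simp add: scaleR_sum_right)
  ultimately show ?thesis
    using mem_homog_coneI[of ?s _ P] s by simp
qed

lemma integer_hull_subset_SA_plus:
  fixes P :: "(real ^ 'n::finite) set"
  assumes "convex P"
  shows "integer_hull P \<subseteq> SA_plus k P"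
proof
  fix x assume x: "x \<in> integer_hull P"
  then have "P \<noteq> {}" by (auto simp: integer_hull_def)
  from x obtain w where w: "\<forall>p\<in>cube01. 0 \<le> w p" "\<forall>p\<in>cube01 - P. w p = 0" "sum w cube01 = 1"
      "(\<Sum>p\<in>cube01. w p *\<^sub>R p) = x" by (auto simp: mem_integer_hull_iff)
  have "(sum w \<alpha>, \<Sum>p\<in>\<alpha>. w p *\<^sub>R p) \<in> homog_cone P" if "\<alpha> \<in> index_family k" for \<alpha>
    using index_family_subset_cube01[OF that] w assms \<open>P \<noteq> {}\<close>
    by (intro weighted_sum_mem_homog_cone) (auto intro: finite_subset[OF _ finite_cube01])
  then show "x \<in> SA_plus k P"
    using barycenter_mem_SA_plus[of w k P] w by auto
qed

text \<open>
  The halves of a split face are presented as faces with one more fixed coordinate, which is the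
  form that an induction on the number of free coordinates needs.
\<close>

lemma SA_plus_liftD:
  assumes "Y \<in> SA_plus_lift k P"
  shows "\<alpha> \<in> index_family k \<Longrightarrow> xhat (mat_col Y \<alpha>) \<in> homog_cone P"
    and "\<beta> \<in> index_family k \<Longrightarrow> S \<inter> T = {} \<Longrightarrow> card S + card T \<le> k - 1 \<Longrightarrow> j \<notin> S \<union> T \<Longrightarrow>
      Y \<beta> (face S 1 \<inter> face T 0)
        = Y \<beta> (face (insert j S) 1 \<inter> face T 0) + Y \<beta> (face S 1 \<inter> face (insert j T) 0)"
    and "\<alpha> \<in> index_family k \<Longrightarrow> \<beta> \<in> index_family k \<Longrightarrow> \<alpha> \<inter> \<beta> = {} \<Longrightarrow> Y \<alpha> \<beta> = 0"
    and "\<alpha>1 \<in> index_family k \<Longrightarrow> \<alpha>2 \<in> index_family k \<Longrightarrow> \<beta>1 \<in> index_family k \<Longrightarrow>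
      \<beta>2 \<in> index_family k \<Longrightarrow> \<alpha>1 \<inter> \<beta>1 = \<alpha>2 \<inter> \<beta>2 \<Longrightarrow> Y \<alpha>1 \<beta>1 = Y \<alpha>2 \<beta>2"
proof -
  note rest = assms[unfolded SA_plus_lift_def mem_Collect_eq, THEN conjunct2, THEN conjunct2]
  show "\<alpha> \<in> index_family k \<Longrightarrow> xhat (mat_col Y \<alpha>) \<in> homog_cone P"
    using rest[THEN conjunct1, rule_format] by (rule conjunct1)
  show "\<beta> \<in> index_family k \<Longrightarrow> S \<inter> T = {} \<Longrightarrow> card S + card T \<le> k - 1 \<Longrightarrow> j \<notin> S \<union> T \<Longrightarrow>
      Y \<beta> (face S 1 \<inter> face T 0)
        = Y \<beta> (face (insert j S) 1 \<inter> face T 0) + Y \<beta> (face S 1 \<inter> face (insert j T) 0)"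
    using rest[THEN conjunct2, THEN conjunct1, rule_format, OF conjI, of S T j \<beta>]
    by (simp add: mat_col_def face_Int_singleton)
  show "\<alpha> \<in> index_family k \<Longrightarrow> \<beta> \<in> index_family k \<Longrightarrow> \<alpha> \<inter> \<beta> = {} \<Longrightarrow> Y \<alpha> \<beta> = 0"
    by (fact rest[THEN conjunct2, THEN conjunct2, THEN conjunct1, rule_format])
  show "\<alpha>1 \<in> index_family k \<Longrightarrow> \<alpha>2 \<in> index_family k \<Longrightarrow> \<beta>1 \<in> index_family k \<Longrightarrow>
      \<beta>2 \<in> index_family k \<Longrightarrow> \<alpha>1 \<inter> \<beta>1 = \<alpha>2 \<inter> \<beta>2 \<Longrightarrow> Y \<alpha>1 \<beta>1 = Y \<alpha>2 \<beta>2"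
    by (fact rest[THEN conjunct2, THEN conjunct2, THEN conjunct2, rule_format])
qed

text \<open>
  Induction on the number of free coordinates.  At level \<open>n\<close> the splitting condition applies to
  every face with at least one free coordinate, so the splitting continues until only vertices
  remain.
\<close>

lemma SA_plus_lift_col_eq_sum_vertices:
  fixes P :: "(real ^ 'n::finite) set" and S T :: "'n set"
  assumes Y: "Y \<in> SA_plus_lift CARD('n) P" and \<beta>: "\<beta> \<in> index_family CARD('n)"
    and "S \<inter> T = {}"
  shows "Y \<beta> (face S 1 \<inter> face T 0) = (\<Sum>p\<in>face S 1 \<inter> face T 0. Y \<beta> {p})"
  using \<open>S \<inter> T = {}\<close>
proof (induction "card (- (S \<union> T))" arbitrary: S T)
  case 0
  then have "- (S \<union> T) = {}" by (metis card_0_eq finite)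
  then have "S \<union> T = UNIV" by blast
  then show ?case using face_Int_eq_singleton[of S T] 0 by simp
next
  case (Suc m)
  from Suc.hyps(2) have "- (S \<union> T) \<noteq> {}" by (metis card.empty nat.simps(3))
  then obtain j where j: "j \<notin> S \<union> T" by blast
  have "card (S \<union> T) < CARD('n)" using j by (intro psubset_card_mono) auto
  then have "card S + card T \<le> CARD('n) - 1"
    using card_Un_disjoint[of S T] Suc.prems by simp
  then have split: "Y \<beta> (face S 1 \<inter> face T 0)
      = Y \<beta> (face (insert j S) 1 \<inter> face T 0) + Y \<beta> (face S 1 \<inter> face (insert j T) 0)"
    using SA_plus_liftD(2)[OF Y \<beta> Suc.prems _ j] by simp
  have "card (- (insert j (S \<union> T))) = m"
  proof -
    have "- (insert j (S \<union> T)) = - (S \<union> T) - {j}" by auto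
    then show ?thesis using j Suc.hyps(2) by simp
  qed
  then have "Y \<beta> (face (insert j S) 1 \<inter> face T 0) = (\<Sum>p\<in>face (insert j S) 1 \<inter> face T 0. Y \<beta> {p})"
      and "Y \<beta> (face S 1 \<inter> face (insert j T) 0) = (\<Sum>p\<in>face S 1 \<inter> face (insert j T) 0. Y \<beta> {p})"
    using Suc.hyps(1)[of "insert j S" T] Suc.hyps(1)[of S "insert j T"] j Suc.prems by auto
  then show ?case
    using split sum_split_coordinate[of "face S 1 \<inter> face T 0" "\<lambda>p. Y \<beta> {p}" j]
      face_subset_cube01[of S 1]
    by (simp only: face_Int_singleton) (simp add: le_infI1)
qed

text \<open>
  A vertex \<open>p\<close> lies in the face \<open>x\<^sub>i = 1\<close>, where consistency identifies the two entries, or it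
  is disjoint from that face, where the entry vanishes.  So the column of \<open>{p}\<close> represents a
  multiple of \<open>p\<close>.
\<close>

lemma SA_plus_lift_vertex_entry:
  fixes P :: "(real ^ 'n::finite) set"
  assumes Y: "Y \<in> SA_plus_lift CARD('n) P" and p: "p \<in> cube01"
  shows "Y (face {i} 1) {p} = Y cube01 {p} * p $ i"
proof -
  note idx = face_singleton_mem_index_family[of "CARD('n)" i] singleton_mem_index_family[OF p]
    cube01_mem_index_family[of "CARD('n)"]
  have one: "1 \<le> CARD('n)" by (simp add: Suc_leI)
  show ?thesis
  proof (cases "p $ i = 1")
    case True
    then have "face {i} 1 \<inter> {p} = cube01 \<inter> {p}" using p by (auto simp: face_def)
    then have "Y (face {i} 1) {p} = Y cube01 {p}"
      using SA_plus_liftD(4)[OF Y idx(1)[OF one] idx(3,2,2)] by blast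
    then show ?thesis using True by simp
  next
    case False
    then have "face {i} 1 \<inter> {p} = {}" "p $ i = 0"
      using p by (auto simp: face_def cube01_def)
    moreover from this have "Y (face {i} 1) {p} = 0"
      using SA_plus_liftD(3)[OF Y idx(1)[OF one] idx(2)] by blast
    ultimately show ?thesis by simp
  qed
qed

lemma SA_plus_CARD_subset_integer_hull:
  fixes P :: "(real ^ 'n::finite) set"
  shows "SA_plus CARD('n) P \<subseteq> integer_hull P"
proof
  fix x assume "x \<in> SA_plus CARD('n) P"
  then obtain Y where Y: "Y \<in> SA_plus_lift CARD('n) P" and x: "xhat (mat_col Y cube01) = (1, x)"
    by (auto simp: SA_plus_def)
  have one: "1 \<le> CARD('n)" by (simp add: Suc_leI)
  define w where "w p = Y cube01 {p}" for p
  have expand: "Y \<beta> cube01 = (\<Sum>p\<in>cube01. Y \<beta> {p})" if "\<beta> \<in> index_family CARD('n)" for \<beta>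
    using SA_plus_lift_col_eq_sum_vertices[OF Y that, of "{}" "{}"] by simp
  have cone: "(w p, w p *\<^sub>R p) \<in> homog_cone P" and nonneg: "0 \<le> w p" if "p \<in> cube01" for p
  proof -
    have "xhat (mat_col Y {p}) = (w p, w p *\<^sub>R p)"
      using SA_plus_lift_vertex_entry[OF Y that]
      by (simp add: xhat_def mat_col_def w_def vec_eq_iff)
    moreover have "xhat (mat_col Y {p}) \<in> homog_cone P"
      using SA_plus_liftD(1)[OF Y singleton_mem_index_family[OF that]] .
    ultimately show "(w p, w p *\<^sub>R p) \<in> homog_cone P" by simp
    then show "0 \<le> w p" by (auto simp: homog_cone_def)
  qed
  \<comment> \<open>A positive multiple of \<open>p\<close> at height \<open>w p\<close> in the cone can only come from \<open>p\<close> itself.\<close>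
  have "w p = 0" if p: "p \<in> cube01 - P" for p
  proof (rule ccontr)
    assume nz: "w p \<noteq> 0"
    obtain q where q: "w p *\<^sub>R p = w p *\<^sub>R q" "q \<in> P"
      using cone[of p] p by (auto simp: homog_cone_def)
    then show False using nz p by simp
  qed
  moreover have "sum w cube01 = 1"
    using expand[OF cube01_mem_index_family] x by (simp add: w_def xhat_def mat_col_def)
  moreover have "(\<Sum>p\<in>cube01. w p *\<^sub>R p) = x"
  proof -
    have "x $ i = Y (face {i} 1) cube01" for i
      using x by (auto simp: xhat_def mat_col_def)
    also have "\<dots> i = (\<Sum>p\<in>cube01. w p * p $ i)" for i
      using expand[OF face_singleton_mem_index_family[OF one]] SA_plus_lift_vertex_entry[OF Y]
      by (simp add: w_def)
    finally show ?thesis by (simp add: vec_eq_iff)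
  qed
  ultimately show "x \<in> integer_hull P"
    using nonneg by (auto simp: mem_integer_hull_iff)
qed

theorem SA_plus_CARD_eq_integer_hull:
  fixes P :: "(real ^ 'n::finite) set"
  assumes "convex P"
  shows "SA_plus CARD('n) P = integer_hull P"
  using SA_plus_CARD_subset_integer_hull integer_hull_subset_SA_plus[OF assms] by blast

section \<open>The cube with the all-ones vertex cut off\<close>

lemma convex_P_poly: "convex (P_poly \<rho> :: (real ^ 'n::finite) set)"
proof (rule convexI)
  fix x y :: "real ^ 'n" and u v :: real
  assume x: "x \<in> P_poly \<rho>" and y: "y \<in> P_poly \<rho>" and uv: "0 \<le> u" "0 \<le> v" "u + v = 1"
  have "0 \<le> u * x $ i + v * y $ i \<and> u * x $ i + v * y $ i \<le> 1" for i
    using x y uv by (auto simp: P_poly_def intro: convex_bound_le)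
  moreover have "(\<Sum>i\<in>UNIV. u * x $ i + v * y $ i) \<le> real CARD('n) - \<rho>"
    using x y uv unfolding P_poly_def sum.distrib sum_distrib_left[symmetric]
    by (intro convex_bound_le) auto
  ultimately show "u *\<^sub>R x + v *\<^sub>R y \<in> P_poly \<rho>"
    by (simp add: P_poly_def)
qed

lemma mem_homog_cone_P_poly:
  fixes v :: "real ^ 'n::finite"
  assumes "\<rho> \<le> real CARD('n)" "\<And>i. 0 \<le> v $ i" "\<And>i. v $ i \<le> l"
    and le: "(\<Sum>i\<in>UNIV. v $ i) \<le> l * (real CARD('n) - \<rho>)"
  shows "(l, v) \<in> homog_cone (P_poly \<rho>)"
proof (cases "l = 0")
  case True
  then have "v = 0" using assms(2,3) by (auto simp: vec_eq_iff intro: antisym)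
  moreover have "(0 :: real ^ 'n) \<in> P_poly \<rho>" using assms(1) by (simp add: P_poly_def)
  ultimately show ?thesis using True by (force simp: homog_cone_def)
next
  case False
  \<comment> \<open>Any coordinate serves: \<open>0 \<le> v\<^sub>i \<le> l\<close> for some \<open>i\<close>.\<close>
  then have l: "l > 0" using assms(2,3)[of undefined] by linarith
  have "(1 / l) *\<^sub>R v \<in> P_poly \<rho>"
    using l assms by (auto simp: P_poly_def sum_divide_distrib[symmetric] field_simps)
  moreover have "v = l *\<^sub>R (1 / l) *\<^sub>R v" using l by simp
  ultimately show ?thesis
    using mem_homog_coneI[of l _ "P_poly \<rho>"] l by fastforce
qed

lemma coordinate_sum_le_on_integer_hull:
  fixes x :: "real ^ 'n::finite"
  assumes "0 < \<rho>" and x: "x \<in> integer_hull (P_poly \<rho>)"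
  shows "(\<Sum>i\<in>UNIV. x $ i) \<le> real CARD('n) - 1"
proof -
  have "(\<Sum>i\<in>UNIV. p $ i) \<le> real CARD('n) - 1" if p: "p \<in> P_poly \<rho> \<inter> cube01" for p :: "real ^ 'n"
  proof -
    obtain S where S: "p = vertex S" using p by (auto simp: cube01_eq_range_vertex)
    have "(\<Sum>i\<in>UNIV. p $ i) = real (card S)" by (simp add: S sum_vertex)
    moreover from this have "card S < CARD('n)" using p \<open>0 < \<rho>\<close> by (simp add: P_poly_def)
    ultimately show ?thesis by linarith
  qed
  moreover have "convex {x :: real ^ 'n. (\<Sum>i\<in>UNIV. x $ i) \<le> real CARD('n) - 1}"
    using convex_halfspace_le[of "1 :: real ^ 'n" "real CARD('n) - 1"]
    by (simp add: inner_vec_def)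
  ultimately have "integer_hull (P_poly \<rho>) \<subseteq> {x :: real ^ 'n. (\<Sum>i\<in>UNIV. x $ i) \<le> real CARD('n) - 1}"
    unfolding integer_hull_def by (intro hull_minimal) auto
  then show ?thesis using x by blast
qed

text \<open>
  Fixing fewer than \<open>n\<close> coordinates leaves one free, and lowering that coordinate of the all-ones
  vertex stays in the face.  This is where \<open>k < n\<close> enters.
\<close>

lemma exists_near_vertex_in_face:
  fixes \<alpha> :: "(real ^ 'n::finite) set"
  assumes "\<alpha> \<in> index_family k" "k < CARD('n)" "vertex UNIV \<in> \<alpha>"
  shows "\<exists>i. vertex (- {i}) \<in> \<alpha>"
proof -
  obtain S T where \<alpha>: "\<alpha> = face S 1 \<inter> face T 0" and "card S + card T \<le> k"
    using assms(1) by (auto simp: index_family_def)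
  have "T = {}" using assms(3) \<alpha> by (auto simp: face_def vertex_def)
  moreover have "S \<noteq> UNIV" using \<open>card S + card T \<le> k\<close> assms(2) by auto
  then obtain i where "i \<notin> S" by blast
  ultimately have "vertex (- {i}) \<in> \<alpha>"
    by (auto simp: \<alpha> face_def vertex_def cube01_def)
  then show ?thesis ..
qed

text \<open>
  A vertex carrying mass has coordinate sum \<open>n - 1\<close>, except that the all-ones vertex has one more.
  Over a face \<open>\<alpha>\<close>, the total is therefore \<open>(n - 1) w(\<alpha>)\<close> plus the mass of the all-ones vertex
  if it lies in \<open>\<alpha>\<close>, and the cone condition asks that this excess be at most
  \<open>(1 - \<rho>) w(\<alpha>)\<close>.
\<close>

lemma SA_plus_P_poly_beyond_integer_hull:
  fixes \<rho> :: real
  assumes k: "k < CARD('n::finite)" and \<rho>: "0 < \<rho>" "\<rho> < 1"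
  shows "\<exists>x \<in> SA_plus k (P_poly \<rho> :: (real ^ 'n) set). real CARD('n) - 1 < (\<Sum>i\<in>UNIV. x $ i)"
proof -
  define n where "n = real CARD('n)"
  have n: "n \<ge> 1" by (simp add: n_def Suc_leI)
  \<comment> \<open>\<open>D\<close> normalises the masses \<open>1 - \<rho>\<close> (once) and \<open>\<rho>\<close> (\<open>n\<close> times) to total \<open>1\<close>.\<close>
  define D where "D = 1 - \<rho> + n * \<rho>"
  have D: "D > 0" using \<rho> n by (simp add: D_def add_pos_nonneg)
  define o1 :: "real ^ 'n" where "o1 = vertex UNIV"
  define near :: "'n \<Rightarrow> real ^ 'n" where "near i = vertex (- {i})" for i
  define w where "w p = (if p = o1 then (1 - \<rho>) / D else if p \<in> range near then \<rho> / D else 0)" for p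
  have near_nth: "near i $ j = of_bool (j \<noteq> i)" for i j
    by (simp add: near_def vertex_def)
  have inj: "inj near"
  proof (rule injI)
    fix i j assume "near i = near j"
    then show "i = j" using near_nth[of i i] near_nth[of j i] by auto
  qed
  have near_o1: "near i \<noteq> o1" for i
    by (auto simp: near_def o1_def vertex_def vec_eq_iff)
  have in_cube: "o1 \<in> cube01" "near i \<in> cube01" for i
    by (auto simp: o1_def near_def cube01_eq_range_vertex)
  have nonneg: "0 \<le> w p" for p using \<rho> D by (simp add: w_def)
  have total: "sum w cube01 = 1"
  proof -
    have "sum w cube01 = sum w (insert o1 (range near))"
      using in_cube by (intro sum.mono_neutral_right) (auto simp: w_def)
    also have "\<dots> = w o1 + sum w (range near)"
      using near_o1[symmetric] by (intro sum.insert) auto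
    also have "sum w (range near) = n * (\<rho> / D)"
      using inj near_o1 by (simp add: sum.reindex w_def n_def)
    also have "w o1 + n * (\<rho> / D) = 1"
      using D by (simp add: w_def add_divide_distrib[symmetric] D_def)
    finally show ?thesis .
  qed
  have coord: "w p * (\<Sum>i\<in>UNIV. p $ i) = (n - 1) * w p + (if p = o1 then (1 - \<rho>) / D else 0)" for p
  proof -
    have o1_sum: "(\<Sum>i\<in>UNIV. o1 $ i) = n" by (simp add: o1_def sum_vertex n_def)
    have near_sum: "(\<Sum>j\<in>UNIV. near i $ j) = n - 1" for i
      by (simp add: near_def sum_vertex n_def Compl_eq_Diff_UNIV card_Diff_singleton of_nat_diff Suc_leI)
    consider "p = o1" | i where "p = near i" | "p \<noteq> o1" "p \<notin> range near" by blast
    then show ?thesis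
    proof cases
      case 1
      have "w o1 * n = (n - 1) * w o1 + w o1" by (simp add: algebra_simps)
      then show ?thesis unfolding 1 o1_sum by (simp add: w_def)
    next
      case 2
      then show ?thesis using near_o1 by (simp add: near_sum)
    next
      case 3
      then show ?thesis by (simp add: w_def)
    qed
  qed
  have coord_sum: "(\<Sum>i\<in>UNIV. (\<Sum>p\<in>A. w p *\<^sub>R p) $ i)
      = (n - 1) * sum w A + (if o1 \<in> A then (1 - \<rho>) / D else 0)" if "A \<subseteq> cube01" for A
  proof -
    have fin: "finite A" using that finite_subset finite_cube01 by blast
    have "(\<Sum>i\<in>UNIV. (\<Sum>p\<in>A. w p *\<^sub>R p) $ i) = (\<Sum>p\<in>A. w p * (\<Sum>i\<in>UNIV. p $ i))"
      by (simp add: sum_distrib_left) (rule sum.swap)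
    also have "\<dots> = (n - 1) * sum w A + (\<Sum>p\<in>A. if p = o1 then (1 - \<rho>) / D else 0)"
      unfolding coord by (simp add: sum.distrib sum_distrib_left)
    finally show ?thesis using fin by simp
  qed
  have "(\<Sum>p\<in>cube01. w p *\<^sub>R p) \<in> SA_plus k (P_poly \<rho>)"
  proof (rule barycenter_mem_SA_plus[OF nonneg total])
    fix \<alpha> :: "(real ^ 'n) set" assume \<alpha>: "\<alpha> \<in> index_family k"
    note sub = index_family_subset_cube01[OF \<alpha>]
    have fin: "finite \<alpha>" using sub finite_subset finite_cube01 by blast
    show "(sum w \<alpha>, \<Sum>p\<in>\<alpha>. w p *\<^sub>R p) \<in> homog_cone (P_poly \<rho>)"
    proof (rule mem_homog_cone_P_poly)
      show "\<rho> \<le> real CARD('n)" using \<rho> n unfolding n_def by linarith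
      have p01: "0 \<le> p $ i \<and> p $ i \<le> 1" if "p \<in> \<alpha>" for p i
      proof -
        have "p $ i \<in> {0, 1}" using sub that unfolding cube01_def by blast
        then show ?thesis by auto
      qed
      show "0 \<le> (\<Sum>p\<in>\<alpha>. w p *\<^sub>R p) $ i" for i
        using nonneg p01 by (simp add: sum_nonneg)
      show "(\<Sum>p\<in>\<alpha>. w p *\<^sub>R p) $ i \<le> sum w \<alpha>" for i
        using nonneg p01 by (simp add: sum_mono mult_left_le)
      have "(if o1 \<in> \<alpha> then (1 - \<rho>) / D else 0) \<le> (1 - \<rho>) * sum w \<alpha>"
      proof (cases "o1 \<in> \<alpha>")
        case True
        then obtain i where i: "near i \<in> \<alpha>"
          using exists_near_vertex_in_face[OF \<alpha> k] by (auto simp: o1_def near_def)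
        \<comment> \<open>The edge from \<open>o1\<close> to \<open>near i\<close> carries mass \<open>1 / D\<close>, of which \<open>o1\<close> holds the fraction
            \<open>1 - \<rho>\<close>; the bound is attained there.\<close>
        have "1 / D = sum w {o1, near i}"
          using near_o1[of i] by (simp add: w_def add_divide_distrib[symmetric])
        also have "\<dots> \<le> sum w \<alpha>"
          using True i fin nonneg by (intro sum_mono2) auto
        finally show ?thesis
          using True \<rho> mult_left_mono[of "1 / D" "sum w \<alpha>" "1 - \<rho>"] by simp
      next
        case False
        then show ?thesis using \<rho> nonneg by (simp add: sum_nonneg)
      qed
      then show "(\<Sum>i\<in>UNIV. (\<Sum>p\<in>\<alpha>. w p *\<^sub>R p) $ i) \<le> sum w \<alpha> * (real CARD('n) - \<rho>)"
        unfolding coord_sum[OF sub] n_def[symmetric] by (simp add: algebra_simps)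
    qed
  qed
  moreover have "real CARD('n) - 1 < (\<Sum>i\<in>UNIV. (\<Sum>p\<in>cube01. w p *\<^sub>R p) $ i)"
    using coord_sum[of cube01] in_cube total D \<rho> by (simp add: n_def)
  ultimately show ?thesis by blast
qed

theorem proposition3:
  fixes \<rho> :: real
  assumes "CARD('n::finite) \<ge> 2" and "0 < \<rho>" and "\<rho> < 1"
  shows "SA_plus_rank (P_poly \<rho> :: (real ^ 'n) set) = enat CARD('n)"
  unfolding SA_plus_rank_def
proof (rule antisym)
  show "(INF k\<in>{k. SA_plus k (P_poly \<rho> :: (real ^ 'n) set) = integer_hull (P_poly \<rho>)}. enat k)
      \<le> enat CARD('n)"
    by (intro INF_lower) (simp add: SA_plus_CARD_eq_integer_hull convex_P_poly)
  have "CARD('n) \<le> k" if "SA_plus k (P_poly \<rho> :: (real ^ 'n) set) = integer_hull (P_poly \<rho>)" for k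
  proof (rule ccontr)
    assume "\<not> CARD('n) \<le> k"
    then obtain x where "x \<in> SA_plus k (P_poly \<rho> :: (real ^ 'n) set)"
        "real CARD('n) - 1 < (\<Sum>i\<in>UNIV. x $ i)"
      using SA_plus_P_poly_beyond_integer_hull[of k \<rho>] assms by (meson not_le)
    then show False
      using that coordinate_sum_le_on_integer_hull[of \<rho> x] assms by simp
  qed
  then show "enat CARD('n)
      \<le> (INF k\<in>{k. SA_plus k (P_poly \<rho> :: (real ^ 'n) set) = integer_hull (P_poly \<rho>)}. enat k)"
    by (intro INF_greatest) auto
qed

end
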